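(* The group $\mathrm{K}^*=\mathrm{SL}(2,\mathbb{R})\times \mathrm{U}(1)$ acts transitively on the set $B=\{v\in\mathbb{R}^4\setminus\{0\} : \Delta^2(v)=0\}$ of single-centered BPS solutions, so that $B\cong \mathrm{K}^*/\mathbb{R}$.
   Context: Four-dimensional pure $\mathcal{N}=2$ supergravity (Einstein–Maxwell theory) has stationary single-centered solutions labelled by four real charges $v=(m,n,q,h)$ (mass, NUT charge, electric charge, magnetic charge). Such a solution is BPS if and only if $\Delta^2(v)=0$, where $\Delta^2(v)=m^2+n^2-q^2-h^2$. Single-centered BPS solutions are identified with their nonzero charge vectors, i.e. with $B=\{v\in\mathbb{R}^4\setminus\{0\}:\Delta^2(v)=0\}$. The group $\mathrm{K}^*$ is the subgroup with Lie algebra $\mathfrak{k}^*=\mathfrak{sl}(2,\mathbb{R})\oplus\mathfrak{u}(1)$ of $\mathrm{SU}(2,1)$, where $t_1,t_2,t_3$ generate $\mathfrak{sl}(2,\mathbb{R})$ and $u$ generates $\mathfrak{u}(1)$. It acts linearly on the charges through an embedding $I:\mathrm{K}^*\hookrightarrow \mathrm{SO}(2,2)$ (the group preserving $\Delta^2$), whose differential sends $t_i\mapsto b_i$ ($i=1,2,3$) and $u\mapsto b_4$, with respect to the ordering $(m,n,q,h)^T$ of the charges, where $$b_1=\begin{pmatrix}0&-1&0&0\\1&0&0&0\\0&0&0&1\\0&0&-1&0\end{pmatrix},\quad b_2=\begin{pmatrix}0&0&-1&0\\0&0&0&-1\\-1&0&0&0\\0&-1&0&0\end{pmatrix},\quad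 b_3=\begin{pmatrix}0&0&0&1\\0&0&-1&0\\0&-1&0&0\\1&0&0&0\end{pmatrix},\quad b_4=\begin{pmatrix}0&1&0&0\\-1&0&0&0\\0&0&0&1\\0&0&-1&0\end{pmatrix}.$$ $\mathrm{K}^*$ is identified with its image $I(\mathrm{K}^* )$, i.e. with the connected Lie subgroup of $\mathrm{SO}(2,2)$ with Lie algebra spanned by $b_1,b_2,b_3,b_4$. The notation $B\cong\mathrm{K}^*/\mathbb{R}$ means an isomorphism of homogeneous spaces, the stabilizer of a point being a one-parameter subgroup isomorphic to the additive group $\mathbb{R}$. *)

theory Defs
  imports
    "HOL-Analysis.Analysis"
    "HOL-Algebra.Group_Action"
    "HOL-Algebra.Left_Coset"
    "HOL-Algebra.Generated_Groups"
begin

section \<open>Smooth maps and smooth homogeneous spaces\<close>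

text \<open>\<open>C_k k U f\<close>: on the open set \<open>U\<close> the map \<open>f\<close> is \<open>k\<close> times continuously differentiable.\<close>

primrec C_k :: "nat \<Rightarrow> 'a set \<Rightarrow> ('a::euclidean_space \<Rightarrow> 'b::euclidean_space) \<Rightarrow> bool" where
  "C_k 0 U f \<longleftrightarrow> continuous_on U f"
| "C_k (Suc k) U f \<longleftrightarrow>
     (\<forall>x\<in>U. f differentiable (at x)) \<and>
     (\<forall>w. C_k k U (\<lambda>x. frechet_derivative f (at x) w))"

text \<open>Smoothness on an arbitrary subset of a Euclidean space means the local existence of smooth
  extensions.  On an embedded submanifold this is smoothness for its manifold structure.\<close>

definition smooth_on :: "'a set \<Rightarrow> ('a::euclidean_space \<Rightarrow> 'b::euclidean_space) \<Rightarrow> bool" where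
  "smooth_on S f \<longleftrightarrow>
     (\<forall>x\<in>S. \<exists>U F. open U \<and> x \<in> U \<and> (\<forall>k. C_k k U F) \<and> (\<forall>y\<in>S \<inter> U. F y = f y))"

definition diffeomorphism :: "'a set \<Rightarrow> 'b set \<Rightarrow> ('a::euclidean_space \<Rightarrow> 'b::euclidean_space) \<Rightarrow> bool"
  where "diffeomorphism S T f \<longleftrightarrow>
     bij_betw f S T \<and> smooth_on S f \<and> smooth_on T (inv_into S f)"

definition coset_topology :: "('a::euclidean_space, 'm) monoid_scheme \<Rightarrow> 'a set \<Rightarrow> 'a set topology" where
  "coset_topology G H = topology (\<lambda>W. W \<subseteq> lcosets\<^bsub>G\<^esub> H \<and>
     openin (top_of_set (carrier G)) {g \<in> carrier G. g <#\<^bsub>G\<^esub> H \<in> W})"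

lemma openin_coset_topology:
  "openin (coset_topology G H) W \<longleftrightarrow> W \<subseteq> lcosets\<^bsub>G\<^esub> H \<and>
     openin (top_of_set (carrier G)) {g \<in> carrier G. g <#\<^bsub>G\<^esub> H \<in> W}"
proof -
  let ?P = "\<lambda>W. {g \<in> carrier G. g <#\<^bsub>G\<^esub> H \<in> W}"
  have "?P (S \<inter> T) = ?P S \<inter> ?P T" for S T by blast
  moreover have "?P (\<Union>K) = \<Union>(?P ` K)" for K by blast
  ultimately have "istopology (\<lambda>W. W \<subseteq> lcosets\<^bsub>G\<^esub> H \<and> openin (top_of_set (carrier G)) (?P W))"
    unfolding istopology_def by (auto simp del: Union_iff intro!: openin_Union)
  then show ?thesis
    unfolding coset_topology_def by (simp add: topology_inverse')
qed

text \<open>A function on an open subset of the quotient manifold \<open>G/H\<close> is smooth iff its pullback along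
  the projection \<open>G \<rightarrow> G/H\<close> is smooth.\<close>

definition smooth_on_cosets ::
  "('a::euclidean_space, 'm) monoid_scheme \<Rightarrow> 'a set \<Rightarrow> 'a set set \<Rightarrow> ('a set \<Rightarrow> real) \<Rightarrow> bool" where
  "smooth_on_cosets G H W F \<longleftrightarrow>
     smooth_on {g \<in> carrier G. g <#\<^bsub>G\<^esub> H \<in> W} (\<lambda>g. F (g <#\<^bsub>G\<^esub> H))"

text \<open>Isomorphism of homogeneous spaces \<open>G/H \<rightarrow> E\<close>: an equivariant diffeomorphism, where a
  diffeomorphism is a homeomorphism identifying the smooth functions on corresponding open sets.\<close>

definition homogeneous_space_iso ::
  "('a::euclidean_space, 'm) monoid_scheme \<Rightarrow> 'a set \<Rightarrow> 'b set \<Rightarrow> ('a \<Rightarrow> 'b \<Rightarrow> 'b) \<Rightarrow>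
   ('a set \<Rightarrow> 'b::euclidean_space) \<Rightarrow> bool" where
  "homogeneous_space_iso G H E \<phi> \<Phi> \<longleftrightarrow>
     homeomorphic_map (coset_topology G H) (top_of_set E) \<Phi> \<and>
     (\<forall>V f. openin (top_of_set E) V \<longrightarrow>
        (smooth_on_cosets G H {C \<in> lcosets\<^bsub>G\<^esub> H. \<Phi> C \<in> V} (f \<circ> \<Phi>) \<longleftrightarrow> smooth_on V f)) \<and>
     (\<forall>g\<in>carrier G. \<forall>C\<in>lcosets\<^bsub>G\<^esub> H. \<Phi> (g <#\<^bsub>G\<^esub> C) = \<phi> g (\<Phi> C))"

section \<open>The group acting on the charges\<close>

definition real_add_group :: "real monoid" where
  "real_add_group = \<lparr>carrier = UNIV, mult = (+), one = 0\<rparr>"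

text \<open>The type \<open>real^'n^'n\<close> carries the componentwise product, so the library's \<open>exp\<close> is not the
  matrix exponential.\<close>

definition mexp :: "real^'n^'n \<Rightarrow> real^'n^'n" where
  "mexp A = (\<Sum>k. (1 / fact k) *\<^sub>R ((\<lambda>M. A ** M) ^^ k) (mat 1))"

text \<open>A charge vector \<open>v = (m, n, q, h)\<close> has components \<open>v$1, v$2, v$3, v$4\<close>.\<close>

definition Delta2 :: "real^4 \<Rightarrow> real" where
  "Delta2 v = (v$1)\<^sup>2 + (v$2)\<^sup>2 - (v$3)\<^sup>2 - (v$4)\<^sup>2"

definition BPS :: "(real^4) set" where
  "BPS = {v. v \<noteq> 0 \<and> Delta2 v = 0}"

definition SO22 :: "(real^4^4) monoid" where
  "SO22 = \<lparr>carrier = {A. det A = 1 \<and> (\<forall>v. Delta2 (A *v v) = Delta2 v)}, mult = (**), one = mat 1\<rparr>"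

definition b1 :: "real^4^4" where
  "b1 = vector [vector [0, -1, 0, 0], vector [1, 0, 0, 0], vector [0, 0, 0, 1], vector [0, 0, -1, 0]]"

definition b2 :: "real^4^4" where
  "b2 = vector [vector [0, 0, -1, 0], vector [0, 0, 0, -1], vector [-1, 0, 0, 0], vector [0, -1, 0, 0]]"

definition b3 :: "real^4^4" where
  "b3 = vector [vector [0, 0, 0, 1], vector [0, 0, -1, 0], vector [0, -1, 0, 0], vector [1, 0, 0, 0]]"

definition b4 :: "real^4^4" where
  "b4 = vector [vector [0, 1, 0, 0], vector [-1, 0, 0, 0], vector [0, 0, 0, 1], vector [0, 0, -1, 0]]"

definition kstar_algebra :: "(real^4^4) set" where
  "kstar_algebra = span {b1, b2, b3, b4}"

text \<open>The connected Lie subgroup with a given Lie algebra is the subgroup generated by the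
  exponentials of that Lie algebra.  As \<open>Kstar\<close> is closed in \<open>SO22\<close>, its Lie group topology and
  smooth structure are those it inherits as a subset of the space of matrices.  It is the image of
  \<open>SL(2,R) \<times> U(1)\<close>, with \<open>SL(2,R)\<close> generated by \<open>b1, b2, b3\<close> and \<open>U(1)\<close> by \<open>b4\<close>; the pair \<open>(-1,-1)\<close>
  acts trivially.\<close>

definition Kstar :: "(real^4^4) monoid" where
  "Kstar = SO22\<lparr>carrier := generate SO22 (mexp ` kstar_algebra)\<rparr>"

definition charge_action :: "real^4^4 \<Rightarrow> real^4 \<Rightarrow> real^4" where
  "charge_action A = (\<lambda>v\<in>BPS. A *v v)"

end

theory Submission
  imports Defs
begin

text \<open>Identify \<open>\<real>\<^sup>4\<close> with \<open>\<complex>\<^sup>2\<close> by \<open>z = m + i n\<close>, \<open>w = q + i h\<close>.  Then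
  \<open>\<Delta>\<^sup>2 = |z|\<^sup>2 - |w|\<^sup>2\<close>, the matrix \<open>b4\<close> is multiplication by \<open>-i\<close>, and \<open>K\<^sup>*\<close> is the full
  group \<open>U(1,1)\<close> of complex-linear isometries of \<open>\<Delta>\<^sup>2\<close>.  The matrix \<open>stab_gen z w\<close> of
  \<open>x \<mapsto> i \<langle>v, x\<rangle> v\<close> for a null vector \<open>v = (z, w)\<close> lies in the Lie algebra and has
  square zero, and a short computation with the unitarity relations shows that the stabilizer of \<open>v\<close>
  is \<open>{1 + t stab_gen z w}\<close>.  The orbit map of \<open>(1, 1)\<close> has the global rational section \<open>lift\<close>,
  given by \<open>diag(z/r, w/r)\<close> times the boost with rapidity \<open>ln r\<close>, \<open>r = |z| = |w|\<close>.  This section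
  gives transitivity, the generation of \<open>U(1,1)\<close> by exponentials, and the smooth inverse of
  \<open>K\<^sup>*/\<real> \<rightarrow> B\<close>.\<close>

section \<open>Calculus of smooth maps\<close>

text \<open>Openness is what makes this work: agreement on \<open>U\<close> is agreement near every
  point, so both functions have the same derivative there and the induction passes to the
  derivatives.\<close>

lemma C_k_cong:
  assumes "open U" "\<And>x. x \<in> U \<Longrightarrow> f x = g x" "C_k k U f"
  shows "C_k k U g"
  using assms(2,3)
proof (induction k arbitrary: f g)
  case 0
  then show ?case using continuous_on_cong[of U U f g] by simp
next
  case (Suc k)
  have d: "(f has_derivative frechet_derivative f (at x)) (at x)" if "x \<in> U" for x
    using Suc.prems(2) that frechet_derivative_works by auto
  have g: "(g has_derivative frechet_derivative f (at x)) (at x)" if "x \<in> U" for x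
    using has_derivative_transform_within_open[OF d[OF that] \<open>open U\<close> that] Suc.prems(1) by simp
  have "frechet_derivative f (at x) = frechet_derivative g (at x)" if "x \<in> U" for x
    using frechet_derivative_at[OF g[OF that]] .
  then have "C_k k U (\<lambda>x. frechet_derivative g (at x) w)" for w
    using Suc.IH[of "\<lambda>x. frechet_derivative f (at x) w"] Suc.prems(2) by simp
  then show ?case using g by (auto simp: differentiable_def)
qed

lemma C_k_subset: "C_k k U f \<Longrightarrow> V \<subseteq> U \<Longrightarrow> C_k k V f"
proof (induction k arbitrary: f)
  case 0
  then show ?case using continuous_on_subset by auto
next
  case (Suc k)
  have "C_k k V (\<lambda>x. frechet_derivative f (at x) w)" for w
    using Suc.prems by (intro Suc.IH) auto
  then show ?case using Suc.prems by auto
qed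

lemma C_k_SucD: "C_k (Suc k) U f \<Longrightarrow> C_k k U f"
proof (induction k arbitrary: f)
  case 0
  then show ?case
    by (auto intro!: continuous_at_imp_continuous_on differentiable_imp_continuous_within)
next
  case (Suc k)
  have "C_k k U (\<lambda>x. frechet_derivative f (at x) w)" for w
    using Suc.prems by (intro Suc.IH) simp
  then show ?case using Suc.prems by simp
qed

lemma C_k_imp_continuous_on: "C_k k U f \<Longrightarrow> continuous_on U f"
  by (induction k) (auto dest: C_k_SucD simp del: C_k.simps(2))

text \<open>Derivatives are unique, so any explicit \<open>f'\<close> may stand for
  \<open>frechet_derivative\<close>. The closure rules below apply this with the usual
  differentiation formulas.\<close>

lemma C_k_SucI:
  assumes "open U" "\<And>x. x \<in> U \<Longrightarrow> (f has_derivative f' x) (at x)"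
    and "\<And>w. C_k k U (\<lambda>x. f' x w)"
  shows "C_k (Suc k) U f"
proof -
  have "C_k k U (\<lambda>x. frechet_derivative f (at x) w)" for w
    using C_k_cong[OF assms(1) _ assms(3)] frechet_derivative_at[OF assms(2)] by fastforce
  then show ?thesis using assms(2) by (auto simp: differentiable_def)
qed

lemma C_k_Suc_has_derivative:
  "C_k (Suc k) U f \<Longrightarrow> x \<in> U \<Longrightarrow> (f has_derivative frechet_derivative f (at x)) (at x)"
  using frechet_derivative_works by auto

lemma C_k_const: "C_k k U (\<lambda>x. c)"
  by (induction k arbitrary: c) auto

lemma C_k_bounded_linear:
  assumes "bounded_linear f" shows "C_k k U f"
proof (cases k)
  case 0
  then show ?thesis using assms linear_continuous_on by auto
next
  case (Suc k)
  have "frechet_derivative f (at x) = f" for x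
    using bounded_linear_imp_has_derivative[OF assms] frechet_derivative_at by metis
  then show ?thesis
    using Suc bounded_linear_imp_differentiable[OF assms] by (simp add: C_k_const)
qed

lemma C_k_add:
  assumes "open U" "C_k k U f" "C_k k U g"
  shows "C_k k U (\<lambda>x. f x + g x)"
  using assms(2,3)
proof (induction k arbitrary: f g)
  case 0
  then show ?case by (simp add: continuous_on_add)
next
  case (Suc k)
  show ?case
    using Suc.prems
    by (intro C_k_SucI[OF \<open>open U\<close> has_derivative_add[OF C_k_Suc_has_derivative C_k_Suc_has_derivative]] Suc.IH)
      auto
qed

lemma C_k_sum:
  assumes "open U" "\<And>i. i \<in> I \<Longrightarrow> C_k k U (f i)"
  shows "C_k k U (\<lambda>x. \<Sum>i\<in>I. f i x)"
  using assms(2)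
  by (induction I rule: infinite_finite_induct) (auto simp: C_k_const intro!: C_k_add \<open>open U\<close>)

text \<open>By the product rule each directional derivative is a sum of two terms of the same
  bilinear shape, with one factor differentiated. The other factor is used one order below its own
  smoothness, hence \<open>C_k_SucD\<close>.\<close>

lemma C_k_bilinear:
  assumes "bounded_bilinear h" "open U" "C_k k U f" "C_k k U g"
  shows "C_k k U (\<lambda>x. h (f x) (g x))"
  using assms(3,4)
proof (induction k arbitrary: f g)
  case 0
  then show ?case using bounded_bilinear.continuous_on[OF assms(1)] by simp
next
  case (Suc k)
  show ?case
    using Suc.prems Suc.prems[THEN C_k_SucD]
    by (intro C_k_SucI[OF \<open>open U\<close> bounded_bilinear.FDERIV[OF assms(1) C_k_Suc_has_derivative C_k_Suc_has_derivative]]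
        C_k_add \<open>open U\<close> Suc.IH)
      auto
qed

lemma C_k_linear_compose:
  assumes "bounded_linear h" "open U" "C_k k U f"
  shows "C_k k U (\<lambda>x. h (f x))"
  using assms(3)
proof (induction k arbitrary: f)
  case 0
  then show ?case using bounded_linear.continuous_on[OF assms(1)] by simp
next
  case (Suc k)
  show ?case
    using Suc.prems
    by (intro C_k_SucI[OF \<open>open U\<close> bounded_linear.has_derivative[OF assms(1) C_k_Suc_has_derivative]] Suc.IH)
      auto
qed

lemma C_k_compose:
  fixes g :: "'a::euclidean_space \<Rightarrow> 'b::euclidean_space" and f :: "'b \<Rightarrow> 'c::euclidean_space"
  assumes "open U" "C_k k U g" "C_k k V f" "g ` U \<subseteq> V"
  shows "C_k k U (\<lambda>x. f (g x))"
  using assms(2,3)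
proof (induction k arbitrary: f)
  case 0
  then show ?case using continuous_on_compose2[of V f U g] assms(4) by simp
next
  case (Suc k)
  let ?Df = "\<lambda>y. frechet_derivative f (at y)" and ?Dg = "\<lambda>x. frechet_derivative g (at x)"
  have f: "(f has_derivative ?Df (g x)) (at (g x))" if "x \<in> U" for x
    using C_k_Suc_has_derivative[OF Suc.prems(2)] that assms(4) by blast
  \<comment> \<open>The chain rule evaluates \<open>?Df\<close> in a direction that varies with
    \<open>x\<close>, while \<open>C_k\<close> speaks of fixed directions only. Expanding the
    direction in the standard basis leaves fixed directions \<open>b\<close> with scalar
    coefficients.\<close>
  have *: "?Df (g x) (?Dg x w) = (\<Sum>b\<in>Basis. (?Dg x w \<bullet> b) *\<^sub>R ?Df (g x) b)" if "x \<in> U" for x w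
  proof -
    interpret bounded_linear "?Df (g x)" using f[OF that] by (rule has_derivative_bounded_linear)
    show ?thesis
      by (subst (1) euclidean_representation[of "?Dg x w", symmetric]) (simp add: sum scaleR)
  qed
  show ?case
  proof (rule C_k_SucI[OF \<open>open U\<close>])
    fix x assume x: "x \<in> U"
    show "((\<lambda>x. f (g x)) has_derivative (\<lambda>w. ?Df (g x) (?Dg x w))) (at x)"
      using has_derivative_compose[OF C_k_Suc_has_derivative[OF Suc.prems(1) x] f[OF x]] .
  next
    fix w
    have S: "C_k k U (\<lambda>x. \<Sum>b\<in>Basis. (?Dg x w \<bullet> b) *\<^sub>R ?Df (g x) b)"
      using Suc.prems C_k_SucD[OF Suc.prems(1)]
      by (intro C_k_sum C_k_bilinear[OF bounded_bilinear_scaleR] \<open>open U\<close>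
          C_k_linear_compose[OF bounded_linear_inner_left] Suc.IH) auto
    show "C_k k U (\<lambda>x. ?Df (g x) (?Dg x w))"
      by (rule C_k_cong[OF \<open>open U\<close> _ S]) (rule *[symmetric])
  qed
qed

text \<open>The derivative is a product of copies of \<open>inverse\<close> and a constant, so the
  induction hypothesis for \<open>inverse\<close> itself suffices.\<close>

lemma C_k_inverse: "C_k k (- {0}) (inverse :: real \<Rightarrow> real)"
proof (induction k)
  case 0
  then show ?case by (auto intro!: continuous_intros)
next
  case (Suc k)
  show ?case
    by (intro C_k_SucI[OF _ has_derivative_inverse'] C_k_linear_compose[OF bounded_linear_minus[OF bounded_linear_ident]]
        C_k_bilinear[OF bounded_bilinear_mult] C_k_const Suc.IH) auto
qed

section \<open>Smoothness on arbitrary subsets through local extensions\<close>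

lemma smooth_onI:
  assumes "open U" "S \<subseteq> U" "\<And>k. C_k k U f"
  shows "smooth_on S f"
  using assms unfolding smooth_on_def by blast

lemma smooth_on_bounded_linear: "bounded_linear f \<Longrightarrow> smooth_on S f"
  by (rule smooth_onI[of UNIV]) (auto intro: C_k_bounded_linear)

lemma smooth_on_cong:
  assumes "smooth_on S f" "\<And>x. x \<in> S \<Longrightarrow> f x = g x"
  shows "smooth_on S g"
  using assms unfolding smooth_on_def by (metis Int_iff)

lemma smooth_on_compose:
  fixes g :: "'a::euclidean_space \<Rightarrow> 'b::euclidean_space" and f :: "'b \<Rightarrow> 'c::euclidean_space"
  assumes "smooth_on S g" "smooth_on T f" "g ` S \<subseteq> T"
  shows "smooth_on S (\<lambda>x. f (g x))"
  unfolding smooth_on_def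
proof
  fix x assume x: "x \<in> S"
  obtain U G where U: "open U" "x \<in> U" "\<And>k. C_k k U G" "\<And>y. y \<in> S \<inter> U \<Longrightarrow> G y = g y"
    using assms(1) x unfolding smooth_on_def by metis
  have "g x \<in> T" using x assms(3) by blast
  then obtain V F where V: "open V" "g x \<in> V" "\<And>k. C_k k V F" "\<And>y. y \<in> T \<inter> V \<Longrightarrow> F y = f y"
    using assms(2) unfolding smooth_on_def by metis
  \<comment> \<open>The extension \<open>G\<close> may leave \<open>V\<close> even though
    \<open>g\<close> does not leave \<open>T\<close>. Its domain is shrunk to the preimage of
    \<open>V\<close>, which is open because \<open>G\<close> is continuous.\<close>
  let ?U = "U \<inter> G -` V"
  have o: "open ?U"
    using continuous_open_preimage[OF C_k_imp_continuous_on[OF U(3)] U(1) V(1)] .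
  have "C_k k ?U (\<lambda>x. F (G x))" for k
    by (rule C_k_compose[OF o C_k_subset[OF U(3)] V(3)]) auto
  moreover have "x \<in> ?U" using U V x by auto
  moreover have "F (G y) = f (g y)" if "y \<in> S \<inter> ?U" for y
    using that U(4)[of y] V(4)[of "g y"] assms(3) by auto
  ultimately show "\<exists>U F. open U \<and> x \<in> U \<and> (\<forall>k. C_k k U F) \<and> (\<forall>y\<in>S \<inter> U. F y = f (g y))"
    using o by blast
qed

lemma smooth_on_subset: "smooth_on T f \<Longrightarrow> S \<subseteq> T \<Longrightarrow> smooth_on S f"
  using smooth_on_compose[OF smooth_on_bounded_linear[OF bounded_linear_ident], of T f S] by simp

lemma smooth_on_imp_continuous_on:
  assumes "smooth_on S f" shows "continuous_on S f"
proof (subst continuous_on_eq_continuous_within, rule ballI)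
  fix x assume x: "x \<in> S"
  from assms[unfolded smooth_on_def, rule_format, OF x]
  obtain U F where U: "open U" "x \<in> U" "\<forall>k. C_k k U F" "\<forall>y\<in>S \<inter> U. F y = f y"
    by (elim exE conjE)
  have "isCont F x"
    using C_k_imp_continuous_on[OF U(3)[rule_format]] U(1,2) by (simp add: continuous_on_eq_continuous_at)
  then have "continuous (at x within S) F" by (rule continuous_at_imp_continuous_at_within)
  then show "continuous (at x within S) f"
    by (rule continuous_transform_within_openin[of _ _ _ "S \<inter> U"]) (use U x in \<open>auto simp: openin_open_Int\<close>)
qed

section \<open>Homogeneous spaces with a global section\<close>

text \<open>The left cosets of the stabilizer are the fibres of the orbit map; this is the
  orbit-stabilizer correspondence at the level of elements.\<close>

lemma stabilizer_lcoset_iff: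
  assumes "group_action G E \<phi>" "v \<in> E" "g \<in> carrier G"
  shows "h \<in> g <#\<^bsub>G\<^esub> stabilizer G \<phi> v \<longleftrightarrow> h \<in> carrier G \<and> \<phi> h v = \<phi> g v"
proof -
  interpret group_action G E \<phi> by fact
  interpret group G using group_hom group_hom.axioms(1) by auto
  show ?thesis
  proof
    assume "h \<in> g <#\<^bsub>G\<^esub> stabilizer G \<phi> v"
    then show "h \<in> carrier G \<and> \<phi> h v = \<phi> g v"
      using assms composition_rule by (auto simp: l_coset_def stabilizer_def)
  next
    assume h: "h \<in> carrier G \<and> \<phi> h v = \<phi> g v"
    then have "\<phi> (inv\<^bsub>G\<^esub> g \<otimes>\<^bsub>G\<^esub> h) v = v"
      using assms orbit_sym_aux composition_rule by simp
    then have "inv\<^bsub>G\<^esub> g \<otimes>\<^bsub>G\<^esub> h \<in> stabilizer G \<phi> v" using h assms by (simp add: stabilizer_def)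
    moreover have "h = g \<otimes>\<^bsub>G\<^esub> (inv\<^bsub>G\<^esub> g \<otimes>\<^bsub>G\<^esub> h)"
      using h assms by (simp flip: m_assoc)
    ultimately show "h \<in> g <#\<^bsub>G\<^esub> stabilizer G \<phi> v" unfolding l_coset_def by blast
  qed
qed

lemma topspace_coset_topology [simp]: "topspace (coset_topology G H) = lcosets\<^bsub>G\<^esub> H"
proof -
  have "{g \<in> carrier G. g <#\<^bsub>G\<^esub> H \<in> lcosets\<^bsub>G\<^esub> H} = carrier G"
    by (auto simp: LCOSETS_def)
  then have "openin (coset_topology G H) (lcosets\<^bsub>G\<^esub> H)"
    by (simp add: openin_coset_topology)
  then show ?thesis
    by (intro antisym openin_subset) (use openin_coset_topology openin_topspace in blast)+
qed

text \<open>A global smooth section \<open>\<sigma>\<close> of the orbit map makes quotient charts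
  unnecessary: the inverse of \<open>\<Phi>\<close> is \<open>\<sigma>\<close> followed by the
  projection. Topology and smooth functions are compared by pulling back along the orbit map in one
  direction and along \<open>\<sigma>\<close> in the other.\<close>

lemma homogeneous_space_iso_if_section:
  fixes G :: "('a::euclidean_space, 'm) monoid_scheme" and E :: "'b::euclidean_space set"
  assumes act: "group_action G E \<phi>" and v: "v \<in> E"
    and orb: "smooth_on (carrier G) (\<lambda>g. \<phi> g v)"
    and sec: "smooth_on E \<sigma>" "\<sigma> ` E \<subseteq> carrier G" "\<And>x. x \<in> E \<Longrightarrow> \<phi> (\<sigma> x) v = x"
  shows "\<exists>\<Phi>. \<Phi> (stabilizer G \<phi> v) = v \<and>
    homogeneous_space_iso G (stabilizer G \<phi> v) E \<phi> \<Phi>"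
proof -
  interpret group_action G E \<phi> by fact
  interpret group G using group_hom group_hom.axioms(1) by auto
  define H where "H = stabilizer G \<phi> v"
  define \<Phi> where "\<Phi> C = \<phi> (SOME g. g \<in> C) v" for C
  have H: "subgroup H G" unfolding H_def by (rule stabilizer_subgroup[OF v])
  \<comment> \<open>The representative chosen in the definition of \<open>\<Phi>\<close> is
    immaterial, since the orbit map is constant on the coset.\<close>
  have \<Phi>: "\<Phi> (g <#\<^bsub>G\<^esub> H) = \<phi> g v" if "g \<in> carrier G" for g
  proof -
    have "g \<in> g <#\<^bsub>G\<^esub> H" using that lcos_self H by blast
    then have "(SOME g'. g' \<in> g <#\<^bsub>G\<^esub> H) \<in> g <#\<^bsub>G\<^esub> H" by (rule someI)
    then show ?thesis using stabilizer_lcoset_iff[OF act v that] unfolding \<Phi>_def H_def by blast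
  qed
  have \<phi>E: "\<phi> g v \<in> E" if "g \<in> carrier G" for g using element_image that v by blast
  have eqc: "g <#\<^bsub>G\<^esub> H = h <#\<^bsub>G\<^esub> H" if "g \<in> carrier G" "h \<in> carrier G" "\<phi> g v = \<phi> h v" for g h
    unfolding H_def using stabilizer_lcoset_iff[OF act v] that by auto
  have lc: "g <#\<^bsub>G\<^esub> H \<in> lcosets\<^bsub>G\<^esub> H" if "g \<in> carrier G" for g
    using that by (auto simp: LCOSETS_def)
  have pre: "{g \<in> carrier G. g <#\<^bsub>G\<^esub> H \<in> {C \<in> lcosets\<^bsub>G\<^esub> H. \<Phi> C \<in> V}} = {g \<in> carrier G. \<phi> g v \<in> V}" for V
    using \<Phi> lc by auto
  have "homeomorphic_maps (coset_topology G H) (top_of_set E) \<Phi> (\<lambda>x. \<sigma> x <#\<^bsub>G\<^esub> H)"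
    unfolding homeomorphic_maps_def
  proof (intro conjI ballI)
    have "openin (coset_topology G H) {C \<in> lcosets\<^bsub>G\<^esub> H. \<Phi> C \<in> V}" if "openin (top_of_set E) V" for V
    proof -
      have "openin (top_of_set (carrier G)) (carrier G \<inter> (\<lambda>g. \<phi> g v) -` V)"
        by (rule continuous_openin_preimage[OF smooth_on_imp_continuous_on[OF orb] _ that]) (use \<phi>E in blast)
      moreover have "carrier G \<inter> (\<lambda>g. \<phi> g v) -` V = {g \<in> carrier G. \<phi> g v \<in> V}" by blast
      ultimately show ?thesis unfolding openin_coset_topology pre by auto
    qed
    then show "continuous_map (coset_topology G H) (top_of_set E) \<Phi>"
      using \<Phi> \<phi>E by (auto simp: continuous_map_def LCOSETS_def)
  next
    have "openin (top_of_set E) {x \<in> E. \<sigma> x <#\<^bsub>G\<^esub> H \<in> W}" if "openin (coset_topology G H) W" for W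
    proof -
      have "openin (top_of_set E) (E \<inter> \<sigma> -` {g \<in> carrier G. g <#\<^bsub>G\<^esub> H \<in> W})"
        by (rule continuous_openin_preimage[where T = "carrier G", OF smooth_on_imp_continuous_on[OF sec(1)]])
          (use sec(2) that[unfolded openin_coset_topology] in auto)
      moreover have "E \<inter> \<sigma> -` {g \<in> carrier G. g <#\<^bsub>G\<^esub> H \<in> W} = {x \<in> E. \<sigma> x <#\<^bsub>G\<^esub> H \<in> W}"
        using sec(2) by blast
      ultimately show ?thesis by simp
    qed
    then show "continuous_map (top_of_set E) (coset_topology G H) (\<lambda>x. \<sigma> x <#\<^bsub>G\<^esub> H)"
      using sec(2) lc by (auto simp: continuous_map_def)
  next
    fix C assume "C \<in> topspace (coset_topology G H)"
    then obtain g where g: "g \<in> carrier G" "C = g <#\<^bsub>G\<^esub> H" by (auto simp: LCOSETS_def)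
    have "\<sigma> (\<phi> g v) <#\<^bsub>G\<^esub> H = g <#\<^bsub>G\<^esub> H"
      using g sec(2,3) \<phi>E by (intro eqc) auto
    then show "\<sigma> (\<Phi> C) <#\<^bsub>G\<^esub> H = C" using g \<Phi> by simp
  next
    fix x assume "x \<in> topspace (top_of_set E)"
    then show "\<Phi> (\<sigma> x <#\<^bsub>G\<^esub> H) = x" using sec \<Phi> by auto
  qed
  then have homeo: "homeomorphic_map (coset_topology G H) (top_of_set E) \<Phi>"
    using homeomorphic_map_maps by blast
  have smooth: "smooth_on_cosets G H {C \<in> lcosets\<^bsub>G\<^esub> H. \<Phi> C \<in> V} (f \<circ> \<Phi>) \<longleftrightarrow> smooth_on V f"
    if V: "openin (top_of_set E) V" for V and f :: "'b \<Rightarrow> real"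
  proof -
    let ?S = "{g \<in> carrier G. \<phi> g v \<in> V}"
    have VE: "V \<subseteq> E" using openin_imp_subset[OF V] .
    have "smooth_on_cosets G H {C \<in> lcosets\<^bsub>G\<^esub> H. \<Phi> C \<in> V} (f \<circ> \<Phi>) \<longleftrightarrow> smooth_on ?S (\<lambda>g. f (\<phi> g v))"
      unfolding smooth_on_cosets_def pre
      using smooth_on_cong[of ?S "\<lambda>g. (f \<circ> \<Phi>) (g <#\<^bsub>G\<^esub> H)" "\<lambda>g. f (\<phi> g v)"]
        smooth_on_cong[of ?S "\<lambda>g. f (\<phi> g v)" "\<lambda>g. (f \<circ> \<Phi>) (g <#\<^bsub>G\<^esub> H)"] \<Phi> by auto
    also have "\<dots> \<longleftrightarrow> smooth_on V f"
    proof
      \<comment> \<open>On \<open>V\<close> the function \<open>f\<close> is its own pullback to the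
        group composed with the section.\<close>
      assume "smooth_on ?S (\<lambda>g. f (\<phi> g v))"
      then have "smooth_on V (\<lambda>x. f (\<phi> (\<sigma> x) v))"
        by (rule smooth_on_compose[OF smooth_on_subset[OF sec(1) VE]]) (use sec(2,3) VE in auto)
      then show "smooth_on V f" by (rule smooth_on_cong) (use sec(3) VE in auto)
    next
      assume "smooth_on V f"
      then show "smooth_on ?S (\<lambda>g. f (\<phi> g v))"
        by (intro smooth_on_compose[where T = V, OF smooth_on_subset[OF orb]]) auto
    qed
    finally show ?thesis .
  qed
  have equi: "\<Phi> (g <#\<^bsub>G\<^esub> C) = \<phi> g (\<Phi> C)" if g: "g \<in> carrier G" and C: "C \<in> lcosets\<^bsub>G\<^esub> H" for g C
  proof -
    obtain h where h: "h \<in> carrier G" "C = h <#\<^bsub>G\<^esub> H" using C by (auto simp: LCOSETS_def)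
    have "g <#\<^bsub>G\<^esub> C = (g \<otimes>\<^bsub>G\<^esub> h) <#\<^bsub>G\<^esub> H"
      using lcos_m_assoc[OF subgroup.subset[OF H] g h(1)] h(2) by simp
    then show ?thesis using g h \<Phi> composition_rule[OF v g h(1)] by simp
  qed
  have "\<Phi> H = v"
  proof -
    have "\<one>\<^bsub>G\<^esub> <#\<^bsub>G\<^esub> H = H" using lcos_mult_one[OF subgroup.subset[OF H]] .
    moreover have "\<phi> \<one>\<^bsub>G\<^esub> v = v" using stabilizer_one_closed[OF v] by (simp add: stabilizer_def)
    ultimately show ?thesis using \<Phi>[of "\<one>\<^bsub>G\<^esub>"] by simp
  qed
  moreover have "homogeneous_space_iso G H E \<phi> \<Phi>"
    unfolding homogeneous_space_iso_def
    by (intro conjI allI impI ballI homeo smooth equi)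
  ultimately show ?thesis unfolding H_def by blast
qed

section \<open>The matrix exponential\<close>

abbreviation mpow :: "real^'n^'n \<Rightarrow> nat \<Rightarrow> real^'n^'n" where
  "mpow A k \<equiv> ((\<lambda>M. A ** M) ^^ k) (mat 1)"

lemma bounded_bilinear_matrix_mult:
  "bounded_bilinear ((**) :: real^'n^'m \<Rightarrow> real^'p^'n \<Rightarrow> real^'p^'m)"
  unfolding bilinear_conv_bounded_bilinear[symmetric] bilinear_def
  by (auto intro!: linearI simp: vec_eq_iff matrix_matrix_mult_def sum.distrib sum_distrib_left algebra_simps)

lemmas matrix_mult_scaleR_left = bounded_bilinear.scaleR_left[OF bounded_bilinear_matrix_mult]
lemmas matrix_mult_scaleR_right = bounded_bilinear.scaleR_right[OF bounded_bilinear_matrix_mult]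

text \<open>Comparison with the scalar exponential series. The boundedness constant \<open>K\<close>
  of matrix multiplication stands in for submultiplicativity of the norm, so powers grow at most
  like those of \<open>norm A * K\<close>.\<close>

lemma mexp_sums:
  fixes A :: "real^'n^'n"
  shows "(\<lambda>k. (1 / fact k) *\<^sub>R mpow A k) sums mexp A"
proof -
  obtain K where K: "0 \<le> K" "\<And>M :: real^'n^'n. norm (A ** M) \<le> norm A * norm M * K"
    using bounded_bilinear.nonneg_bounded[OF bounded_bilinear_matrix_mult] by metis
  let ?c = "norm A * K"
  have "norm (mpow A k) \<le> ?c ^ k * norm (mat 1 :: real^'n^'n)" for k
  proof (induction k)
    case (Suc k)
    have "norm (mpow A (Suc k)) \<le> ?c * norm (mpow A k)"
      using K(2)[of "mpow A k"] by (simp add: mult_ac)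
    also have "\<dots> \<le> ?c * (?c ^ k * norm (mat 1 :: real^'n^'n))"
      using K(1) by (intro mult_left_mono Suc.IH) simp
    finally show ?case by (simp add: mult_ac)
  qed simp
  then have "norm ((1 / fact k) *\<^sub>R mpow A k) \<le> inverse (fact k) * ?c ^ k * norm (mat 1 :: real^'n^'n)" for k
    by (simp add: divide_simps mult.assoc)
  then have "summable (\<lambda>k. (1 / fact k) *\<^sub>R mpow A k)"
    by (intro summable_comparison_test[OF _ summable_mult2[OF summable_exp]]) blast
  then show ?thesis unfolding mexp_def by (rule summable_sums)
qed

lemma mexp_eqI: "(\<lambda>k. (1 / fact k) *\<^sub>R mpow A k) sums B \<Longrightarrow> mexp A = B"
  using mexp_sums sums_unique2 by blast

lemma mpow_scaleR: "mpow (t *\<^sub>R A) k = t ^ k *\<^sub>R mpow A k"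
  by (induction k) (simp_all add: matrix_mult_scaleR_left matrix_mult_scaleR_right)

lemma mexp_nilpotent:
  assumes "A ** A = 0" shows "mexp A = mat 1 + A"
proof (rule mexp_eqI)
  have z: "mpow A k = 0" if k: "k \<notin> {0, 1}" for k
  proof -
    obtain j where "k = Suc (Suc j)" using k by (cases k; cases "k - 1") auto
    then show ?thesis
      by (simp add: matrix_mul_assoc assms bounded_bilinear.zero_left[OF bounded_bilinear_matrix_mult])
  qed
  show "(\<lambda>k. (1 / fact k) *\<^sub>R mpow A k) sums (mat 1 + A)"
    using sums_finite[of "{0,1}" "\<lambda>k. (1 / fact k) *\<^sub>R mpow A k"] z by simp
qed

lemma mexp_0: "mexp 0 = mat 1"
  using mexp_nilpotent[of 0] by (simp add: bounded_bilinear.zero_left[OF bounded_bilinear_matrix_mult])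

text \<open>\<open>L\<close> turns multiplication by \<open>c\<close> into left multiplication by
  \<open>A\<close>, hence carries the series of \<open>exp c\<close> term by term to that of
  \<open>mexp A\<close>. It serves for matrices that are diagonal in complex coordinates.\<close>

lemma mexp_functional_calculus:
  fixes c :: "'a::{real_normed_algebra_1,banach}"
  assumes "bounded_linear L" "L 1 = mat 1" "\<And>z. A ** L z = L (c * z)"
  shows "mexp A = L (exp c)"
proof (rule mexp_eqI)
  have "mpow A k = L (c ^ k)" for k
    by (induction k) (simp_all add: assms)
  then show "(\<lambda>k. (1 / fact k) *\<^sub>R mpow A k) sums L (exp c)"
    using bounded_linear.sums[OF assms(1) exp_converges[of c]] 
    by (simp add: linear_cmul[OF bounded_linear.linear[OF assms(1)]] inverse_eq_divide)
qed

text \<open>\<open>A\<close> acts on the summands \<open>p\<close> and \<open>q\<close> of the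
  identity by the scalars \<open>r\<close> and \<open>s\<close>, so its powers split as
  \<open>r ^ k\<close> and \<open>s ^ k\<close> times these summands. It serves for the boosts
  generated by \<open>b2\<close>.\<close>

lemma mexp_eigenprojections:
  assumes "p + q = mat 1" "A ** p = r *\<^sub>R p" "A ** q = s *\<^sub>R q"
  shows "mexp A = exp r *\<^sub>R p + exp s *\<^sub>R q"
proof (rule mexp_eqI)
  have "mpow A k = r ^ k *\<^sub>R p + s ^ k *\<^sub>R q" for k
    by (induction k)
      (simp_all add: assms matrix_add_ldistrib matrix_mult_scaleR_right mult.commute)
  moreover have "(\<lambda>k. (r ^ k /\<^sub>R fact k) *\<^sub>R p + (s ^ k /\<^sub>R fact k) *\<^sub>R q) sums (exp r *\<^sub>R p + exp s *\<^sub>R q)"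
    by (intro sums_add bounded_linear.sums[OF bounded_linear_scaleR_left] exp_converges)
  ultimately show "(\<lambda>k. (1 / fact k) *\<^sub>R mpow A k) sums (exp r *\<^sub>R p + exp s *\<^sub>R q)"
    by (simp add: scaleR_add_right inverse_eq_divide)
qed

lemma mexp_commute:
  assumes "A ** B = B ** A" shows "mexp A ** B = B ** mexp A"
proof -
  have "mpow A k ** B = B ** mpow A k" for k
    by (induction k) (simp_all add: matrix_mul_assoc[symmetric], simp add: matrix_mul_assoc assms)
  then have "(\<lambda>k. ((1 / fact k) *\<^sub>R mpow A k) ** B) sums (B ** mexp A)"
    using bounded_linear.sums[OF bounded_bilinear.bounded_linear_right[OF bounded_bilinear_matrix_mult] mexp_sums[of A], of B]
    by (simp add: matrix_mult_scaleR_left matrix_mult_scaleR_right)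
  then show ?thesis
    using bounded_linear.sums[OF bounded_bilinear.bounded_linear_left[OF bounded_bilinear_matrix_mult] mexp_sums[of A], of B]
      sums_unique2 by blast
qed

text \<open>Each entry is a power series in \<open>t\<close> that converges everywhere, so it can be
  differentiated term by term.\<close>

lemma mexp_nth_has_derivative:
  "((\<lambda>t. mexp (t *\<^sub>R X) $ i $ j) has_real_derivative (X ** mexp (t *\<^sub>R X)) $ i $ j) (at t)"
proof -
  define c where "c k = mpow X k $ i $ j / fact k" for k
  have nth: "bounded_linear (\<lambda>M::real^'a^'a. M $ i $ j)"
    by (intro bounded_linear_compose[OF bounded_linear_vec_nth] bounded_linear_vec_nth)
  have s: "(\<lambda>k. c k * y ^ k) sums (mexp (y *\<^sub>R X) $ i $ j)" for y
    using bounded_linear.sums[OF nth mexp_sums[of "y *\<^sub>R X"]] by (simp add: c_def mpow_scaleR mult.commute)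
  \<comment> \<open>The index shift in \<open>diffs\<close> turns \<open>1 / fact (Suc k)\<close>
    into \<open>1 / fact k\<close> and leaves one extra factor \<open>X\<close> on the left.\<close>
  have d: "diffs c k * y ^ k = (X ** ((1 / fact k) *\<^sub>R mpow (y *\<^sub>R X) k)) $ i $ j" for k y
    by (simp add: diffs_def c_def mpow_scaleR matrix_mult_scaleR_right del: of_nat_Suc)
  have "(\<lambda>k. diffs c k * t ^ k) sums ((X ** mexp (t *\<^sub>R X)) $ i $ j)"
    unfolding d
    by (intro bounded_linear.sums[OF nth] mexp_sums
        bounded_linear.sums[OF bounded_bilinear.bounded_linear_right[OF bounded_bilinear_matrix_mult]])
  moreover have "((\<lambda>t. \<Sum>k. c k * t ^ k) has_real_derivative (\<Sum>k. diffs c k * t ^ k)) (at t)"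
    using s by (intro termdiffs_strong_converges_everywhere) (auto simp: sums_iff)
  ultimately show ?thesis using s by (simp add: sums_iff)
qed

lemma mexp_vec_nth_has_derivative:
  "((\<lambda>t. (mexp (t *\<^sub>R X) *v v) $ i) has_real_derivative (X *v (mexp (t *\<^sub>R X) *v v)) $ i) (at t)"
proof -
  have "((\<lambda>t. \<Sum>j\<in>UNIV. mexp (t *\<^sub>R X) $ i $ j * v $ j) has_real_derivative
      (\<Sum>j\<in>UNIV. (X ** mexp (t *\<^sub>R X)) $ i $ j * v $ j)) (at t)"
    by (intro DERIV_sum DERIV_cmult_right mexp_nth_has_derivative)
  then show ?thesis
    unfolding matrix_vector_mul_assoc by (simp add: matrix_vector_mult_def)
qed

section \<open>Complex coordinates and \<open>U(1,1)\<close>\<close>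

lemma vector_4:
  "(vector [a,b,c,d] :: ('a::zero)^4)$1 = a" "(vector [a,b,c,d] :: 'a^4)$2 = b"
  "(vector [a,b,c,d] :: 'a^4)$3 = c" "(vector [a,b,c,d] :: 'a^4)$4 = d"
  unfolding vector_def by simp_all

lemma det_4:
  fixes A :: "'a::comm_ring_1^4^4"
  shows "det A =
    A$1$1 * (A$2$2 * (A$3$3 * A$4$4 - A$3$4 * A$4$3) - A$2$3 * (A$3$2 * A$4$4 - A$3$4 * A$4$2) + A$2$4 * (A$3$2 * A$4$3 - A$3$3 * A$4$2))
  - A$1$2 * (A$2$1 * (A$3$3 * A$4$4 - A$3$4 * A$4$3) - A$2$3 * (A$3$1 * A$4$4 - A$3$4 * A$4$1) + A$2$4 * (A$3$1 * A$4$3 - A$3$3 * A$4$1))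
  + A$1$3 * (A$2$1 * (A$3$2 * A$4$4 - A$3$4 * A$4$2) - A$2$2 * (A$3$1 * A$4$4 - A$3$4 * A$4$1) + A$2$4 * (A$3$1 * A$4$2 - A$3$2 * A$4$1))
  - A$1$4 * (A$2$1 * (A$3$2 * A$4$3 - A$3$3 * A$4$2) - A$2$2 * (A$3$1 * A$4$3 - A$3$3 * A$4$1) + A$2$3 * (A$3$1 * A$4$2 - A$3$2 * A$4$1))"
proof -
  have f1: "finite {2::4,3,4}" "1 \<notin> {2::4,3,4}"
     and f2: "finite {3::4,4}" "2 \<notin> {3::4,4}"
     and f3: "finite {4::4}" "3 \<notin> {4::4}" by auto
  show ?thesis
    unfolding det_def UNIV_4
    unfolding sum_over_permutations_insert[OF f1]
    unfolding sum_over_permutations_insert[OF f2]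
    unfolding sum_over_permutations_insert[OF f3]
    unfolding permutes_sing
    by (simp add: sign_swap_id permutation_swap_id permutation_compose sign_compose sign_id swap_id_eq algebra_simps)
qed

definition cvec :: "complex \<Rightarrow> complex \<Rightarrow> real^4" where
  "cvec z w = vector [Re z, Im z, Re w, Im w]"

text \<open>The complex matrix with rows \<open>(a, b)\<close> and \<open>(c, d)\<close>, each entry
  x + iy being replaced by the real block with rows (x, -y) and (y, x).\<close>

definition cmat :: "complex \<Rightarrow> complex \<Rightarrow> complex \<Rightarrow> complex \<Rightarrow> real^4^4" where
  "cmat a b c d = vector
     [vector [Re a, - Im a, Re b, - Im b], vector [Im a, Re a, Im b, Re b],
      vector [Re c, - Im c, Re d, - Im d], vector [Im c, Re c, Im d, Re d]]"

lemmas cmat_simps = cmat_def cvec_def vec_eq_iff forall_4 vector_4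
  matrix_vector_mult_def matrix_matrix_mult_def sum_4 mat_def

lemma cvec_nth [simp]: "cvec z w $ 1 = Re z" "cvec z w $ 2 = Im z" "cvec z w $ 3 = Re w" "cvec z w $ 4 = Im w"
  by (simp_all add: cvec_def vector_4)

lemma cvec_cases: obtains z w where "v = cvec z w"
proof
  show "v = cvec (Complex (v$1) (v$2)) (Complex (v$3) (v$4))" by (simp add: vec_eq_iff forall_4)
qed

lemma cvec_inject [simp]: "cvec z w = cvec z' w' \<longleftrightarrow> z = z' \<and> w = w'"
  by (auto simp: vec_eq_iff forall_4 complex_eq_iff)

lemma cvec_eq_0_iff [simp]: "cvec z w = 0 \<longleftrightarrow> z = 0 \<and> w = 0"
  by (auto simp: vec_eq_iff forall_4 complex_eq_iff)

lemma cmat_cvec [simp]: "cmat a b c d *v cvec z w = cvec (a * z + b * w) (c * z + d * w)"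
  by (simp add: cmat_simps algebra_simps)

lemma cmat_mult [simp]:
  "cmat a b c d ** cmat a' b' c' d' =
     cmat (a * a' + b * c') (a * b' + b * d') (c * a' + d * c') (c * b' + d * d')"
  by (simp add: cmat_simps algebra_simps)

lemma cmat_inject [simp]:
  "cmat a b c d = cmat a' b' c' d' \<longleftrightarrow> a = a' \<and> b = b' \<and> c = c' \<and> d = d'"
  by (auto simp: cmat_simps complex_eq_iff)

lemma cmat_add: "cmat a b c d + cmat a' b' c' d' = cmat (a + a') (b + b') (c + c') (d + d')"
  by (simp add: cmat_simps)

lemma cmat_scaleR: "r *\<^sub>R cmat a b c d = cmat (r *\<^sub>R a) (r *\<^sub>R b) (r *\<^sub>R c) (r *\<^sub>R d)"
  by (simp add: cmat_simps)

lemma cmat_1: "mat 1 = cmat 1 0 0 1"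
  by (simp add: cmat_simps)

text \<open>In this form the generators are visibly a basis of the Lie algebra u(1,1):
  \<open>b1\<close>, \<open>b2\<close>, \<open>b3\<close> are traceless and span su(1,1), and
  \<open>b4\<close> is a central scalar.\<close>

lemma b_cmat: "b1 = cmat \<i> 0 0 (-\<i>)" "b2 = cmat 0 (-1) (-1) 0" "b3 = cmat 0 (-\<i>) \<i> 0" "b4 = cmat (-\<i>) 0 0 (-\<i>)"
  by (simp_all add: b1_def b2_def b3_def b4_def cmat_simps)

text \<open>Commuting with multiplication by -i is complex linearity. The entries of the commutator
  identity in rows 1 and 3 already give the block form.\<close>

lemma commute_b4_imp_cmat:
  assumes "A ** b4 = b4 ** A" obtains a b c d where "A = cmat a b c d"
proof
  have E: "(A ** b4) $ i $ j = (b4 ** A) $ i $ j" for i j using assms by simp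
  have "A$1$2 = - A$2$1" "A$2$2 = A$1$1" "A$1$4 = - A$2$3" "A$2$4 = A$1$3"
       "A$3$2 = - A$4$1" "A$4$2 = A$3$1" "A$3$4 = - A$4$3" "A$4$4 = A$3$3"
    using E[of 1 1] E[of 1 2] E[of 1 3] E[of 1 4] E[of 3 1] E[of 3 2] E[of 3 3] E[of 3 4]
    by (simp_all add: b4_def matrix_matrix_mult_def sum_4 vector_4)
  then show "A = cmat (Complex (A$1$1) (A$2$1)) (Complex (A$1$3) (A$2$3)) (Complex (A$3$1) (A$4$1)) (Complex (A$3$3) (A$4$3))"
    by (simp add: cmat_def vec_eq_iff forall_4 vector_4)
qed

section \<open>The indefinite Hermitian form and its unitary group\<close>

lemma Delta2_cvec [simp]: "Delta2 (cvec z w) = (cmod z)\<^sup>2 - (cmod w)\<^sup>2"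
  by (simp add: Delta2_def cmod_power2)

text \<open>The real determinant of a complex-linear map is the squared modulus of its complex
  determinant.\<close>

lemma det_cmat: "det (cmat a b c d) = (cmod (a * d - b * c))\<^sup>2"
  unfolding cmod_power2 by (simp add: det_4 cmat_def vector_4 power2_eq_square algebra_simps)

definition U11 :: "(real^4^4) set" where
  "U11 = {A. A ** b4 = b4 ** A \<and> (\<forall>v. Delta2 (A *v v) = Delta2 v)}"

text \<open>The conditions say that the two columns are orthonormal for the Hermitian form of
  signature (1,1); the equivalence is polarization.\<close>

lemma cmat_in_U11_iff:
  "cmat a b c d \<in> U11 \<longleftrightarrow>
     (cmod a)\<^sup>2 - (cmod c)\<^sup>2 = 1 \<and> (cmod d)\<^sup>2 - (cmod b)\<^sup>2 = 1 \<and> cnj a * b = cnj c * d"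
proof
  assume L: "cmat a b c d \<in> U11"
  have "(cmod (a * z + b * w))\<^sup>2 - (cmod (c * z + d * w))\<^sup>2 = (cmod z)\<^sup>2 - (cmod w)\<^sup>2" for z w
    using L cmat_cvec[of a b c d z w] Delta2_cvec unfolding U11_def by (metis (mono_tags, lifting) mem_Collect_eq)
  \<comment> \<open>The two unit vectors give the norms of the columns; the other two vectors give
    the real and imaginary parts of their product.\<close>
  from this[of 1 0] this[of 0 1] this[of 1 1] this[of 1 \<i>]
  show "(cmod a)\<^sup>2 - (cmod c)\<^sup>2 = 1 \<and> (cmod d)\<^sup>2 - (cmod b)\<^sup>2 = 1 \<and> cnj a * b = cnj c * d"
    unfolding cmod_power2 by (simp add: complex_eq_iff power2_eq_square algebra_simps)
next
  assume R: "(cmod a)\<^sup>2 - (cmod c)\<^sup>2 = 1 \<and> (cmod d)\<^sup>2 - (cmod b)\<^sup>2 = 1 \<and> cnj a * b = cnj c * d"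
  have "(cmod (a * z + b * w))\<^sup>2 - (cmod (c * z + d * w))\<^sup>2 =
      ((cmod a)\<^sup>2 - (cmod c)\<^sup>2) * (cmod z)\<^sup>2 - ((cmod d)\<^sup>2 - (cmod b)\<^sup>2) * (cmod w)\<^sup>2
      + 2 * Re ((cnj a * b - cnj c * d) * cnj z * w)" for z w
    unfolding cmod_power2 by (simp add: power2_eq_square algebra_simps)
  then have "Delta2 (cmat a b c d *v v) = Delta2 v" for v
    using R by (cases v rule: cvec_cases) simp
  then show "cmat a b c d \<in> U11" by (simp add: U11_def b_cmat)
qed

text \<open>Taking moduli in the orthogonality relation and using the norm relations gives |b| =
  |c|. With r = |c|^2 the squared modulus of ad - bc becomes (1 + r)^2 + r^2 - 2r(1 + r) =
  1.\<close>

lemma U11_det: assumes "A \<in> U11" shows "det A = 1"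
proof -
  obtain a b c d where A: "A = cmat a b c d"
    using assms commute_b4_imp_cmat unfolding U11_def by blast
  note R = assms[unfolded A cmat_in_U11_iff]
  define p q r s where d: "p = (cmod a)\<^sup>2" "q = (cmod b)\<^sup>2" "r = (cmod c)\<^sup>2" "s = (cmod d)\<^sup>2"
  have 1: "p = 1 + r" "s = 1 + q" using R d by auto
  have "cmod (cnj a * b) = cmod (cnj c * d)" using R by simp
  then have "(cmod a * cmod b)\<^sup>2 = (cmod c * cmod d)\<^sup>2" by (simp add: norm_mult)
  then have pq: "p * q = r * s" by (simp add: d power_mult_distrib)
  then have qr: "q = r" using 1 by (simp add: algebra_simps)
  \<comment> \<open>This is the cross term in the expansion of |ad - bc|^2.\<close>
  have "Re ((cnj a * b) * (cnj d * c)) = Re ((cnj c * d) * (cnj d * c))" using R by simp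
  also have "\<dots> = r * s" unfolding d cmod_power2 by (simp add: power2_eq_square algebra_simps)
  finally have "(cmod (a * d - b * c))\<^sup>2 = p * s + q * r - 2 * (r * s)"
    unfolding d cmod_power2 by (simp add: power2_eq_square algebra_simps)
  then show ?thesis using 1 qr by (simp add: A det_cmat algebra_simps)
qed

lemma group_SO22: "group SO22"
proof (rule groupI)
  fix A assume A: "A \<in> carrier SO22"
  then have "invertible A" by (simp add: SO22_def invertible_det_nz)
  then obtain B where inv: "A ** B = mat 1" "B ** A = mat 1"
    unfolding invertible_def by blast
  have "Delta2 (B *v v) = Delta2 v" for v
    using A inv(1) unfolding SO22_def
    by (metis (mono_tags, lifting) mem_Collect_eq matrix_vector_mul_assoc matrix_vector_mul_lid partial_object.select_convs(1))
  moreover have "det B = 1"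
    using arg_cong[OF inv(1), of det] A by (simp add: det_mul SO22_def)
  ultimately show "\<exists>B\<in>carrier SO22. B \<otimes>\<^bsub>SO22\<^esub> A = \<one>\<^bsub>SO22\<^esub>"
    using inv by (intro bexI[of _ B]) (auto simp: SO22_def)
qed (auto simp: SO22_def det_mul matrix_mul_assoc simp flip: matrix_vector_mul_assoc)

lemma inv_SO22: "A \<in> carrier SO22 \<Longrightarrow> inv\<^bsub>SO22\<^esub> A ** A = mat 1 \<and> A ** inv\<^bsub>SO22\<^esub> A = mat 1"
  using group.l_inv[OF group_SO22, of A] group.r_inv[OF group_SO22, of A] by (simp add: SO22_def)

lemma U11_subgroup: "subgroup U11 SO22"
proof
  show sub: "U11 \<subseteq> carrier SO22" using U11_det by (auto simp: SO22_def U11_def)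
  show "x \<otimes>\<^bsub>SO22\<^esub> y \<in> U11" if "x \<in> U11" "y \<in> U11" for x y
  proof -
    have "x ** y ** b4 = b4 ** (x ** y)"
      using that unfolding U11_def by (metis (mono_tags, lifting) matrix_mul_assoc mem_Collect_eq)
    then show ?thesis using that by (auto simp: U11_def SO22_def simp flip: matrix_vector_mul_assoc)
  qed
  show "\<one>\<^bsub>SO22\<^esub> \<in> U11" by (simp add: U11_def SO22_def)
  fix A assume A: "A \<in> U11"
  let ?B = "inv\<^bsub>SO22\<^esub> A"
  have B: "?B \<in> carrier SO22" "?B ** A = mat 1" "A ** ?B = mat 1"
    using A sub inv_SO22 group.inv_closed[OF group_SO22] by auto
  have "?B ** b4 = ?B ** (b4 ** A) ** ?B"
    using B(3) by (simp flip: matrix_mul_assoc)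
  also have "b4 ** A = A ** b4"
    using A by (simp add: U11_def)
  also have "?B ** (A ** b4) ** ?B = (?B ** A) ** b4 ** ?B"
    by (simp add: matrix_mul_assoc)
  finally have "?B ** b4 = b4 ** ?B" by (simp add: B(2))
  then show "?B \<in> U11" using B(1) by (simp add: U11_def SO22_def)
qed

section \<open>The group \<open>Kstar\<close> and its action on \<open>BPS\<close>\<close>

lemma kstar_algebra_iff:
  "X \<in> kstar_algebra \<longleftrightarrow> (\<exists>s t u v. X = s *\<^sub>R b1 + t *\<^sub>R b2 + u *\<^sub>R b3 + v *\<^sub>R b4)"
  unfolding kstar_algebra_def span_breakdown_eq span_empty singleton_iff
  by (simp add: diff_diff_eq add.assoc)

lemma scaleR_b_in_kstar_algebra:
  "t *\<^sub>R b1 \<in> kstar_algebra" "t *\<^sub>R b2 \<in> kstar_algebra" "t *\<^sub>R b3 \<in> kstar_algebra" "t *\<^sub>R b4 \<in> kstar_algebra"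
  by (simp_all add: kstar_algebra_def span_base span_scale)

text \<open>The second claim is infinitesimal invariance: its left side is half the derivative of
  \<open>Delta2\<close> at \<open>v\<close> in the direction \<open>X *v v\<close>.\<close>

lemma kstar_algebra_commute_skew:
  assumes "X \<in> kstar_algebra"
  shows "X ** b4 = b4 ** X"
    and "v$1 * (X *v v)$1 + v$2 * (X *v v)$2 - v$3 * (X *v v)$3 - v$4 * (X *v v)$4 = 0"
proof -
  obtain r s t u where "X = r *\<^sub>R b1 + s *\<^sub>R b2 + t *\<^sub>R b3 + u *\<^sub>R b4"
    using assms kstar_algebra_iff by blast
  then have X: "X = cmat (\<i> * (r - u)) (- s - \<i> * t) (- s + \<i> * t) (- \<i> * (r + u))"
    by (simp add: b_cmat cmat_add cmat_scaleR complex_eq_iff)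
  show "X ** b4 = b4 ** X" by (simp add: X b_cmat mult.commute)
  show "v$1 * (X *v v)$1 + v$2 * (X *v v)$2 - v$3 * (X *v v)$3 - v$4 * (X *v v)$4 = 0"
    by (cases v rule: cvec_cases) (simp add: X algebra_simps)
qed

text \<open>Along the curve \<open>mexp (t *\<^sub>R X) *v v\<close> the derivative of
  \<open>Delta2\<close> vanishes by skewness, so the values at \<open>t = 1\<close> and
  \<open>t = 0\<close> agree.\<close>

lemma mexp_in_U11:
  assumes X: "X \<in> kstar_algebra" shows "mexp X \<in> U11"
proof -
  have "Delta2 (mexp X *v v) = Delta2 v" for v
  proof -
    let ?u = "\<lambda>t. mexp (t *\<^sub>R X) *v v"
    have "((\<lambda>t. Delta2 (?u t)) has_real_derivative 0) (at t)" for t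
    proof -
      have "((\<lambda>t. Delta2 (?u t)) has_real_derivative
         2 * (?u t$1 * (X *v ?u t)$1 + ?u t$2 * (X *v ?u t)$2 - ?u t$3 * (X *v ?u t)$3 - ?u t$4 * (X *v ?u t)$4)) (at t)"
        unfolding Delta2_def
        by (rule derivative_eq_intros mexp_vec_nth_has_derivative refl)+ (simp add: algebra_simps)
      then show ?thesis unfolding kstar_algebra_commute_skew(2)[OF X] by simp
    qed
    then have "Delta2 (?u 1) = Delta2 (?u 0)" by (intro DERIV_isconst_all) blast
    then show ?thesis by (simp add: mexp_0)
  qed
  then show ?thesis
    using mexp_commute[OF kstar_algebra_commute_skew(1)[OF X]] by (simp add: U11_def)
qed

section \<open>Explicit one-parameter subgroups\<close>

lemma cmat_diag_bounded_linear:
  "bounded_linear (\<lambda>z. cmat z 0 0 z)" "bounded_linear (\<lambda>z. cmat z 0 0 (cnj z))"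
  unfolding linear_conv_bounded_linear[symmetric]
  by (auto intro!: linearI simp: cmat_add cmat_scaleR)

lemma mexp_b1: "mexp (t *\<^sub>R b1) = cmat (cis t) 0 0 (cis (- t))"
proof -
  have "t *\<^sub>R b1 = cmat (\<i> * t) 0 0 (- (\<i> * t))"
    by (simp add: b_cmat cmat_scaleR complex_eq_iff)
  then show ?thesis
    using mexp_functional_calculus[OF cmat_diag_bounded_linear(2), of "t *\<^sub>R b1" "\<i> * t"]
    by (simp add: cmat_1 cis_conv_exp exp_cnj)
qed

lemma mexp_b4: "mexp (t *\<^sub>R b4) = cmat (cis (- t)) 0 0 (cis (- t))"
proof -
  have "t *\<^sub>R b4 = cmat (- (\<i> * t)) 0 0 (- (\<i> * t))"
    by (simp add: b_cmat cmat_scaleR complex_eq_iff)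
  then show ?thesis
    using mexp_functional_calculus[OF cmat_diag_bounded_linear(1), of "t *\<^sub>R b4" "- (\<i> * t)"]
    by (simp add: cmat_1 cis_conv_exp)
qed

text \<open>The two matrices project onto the lines through (1, -1) and (1, 1), where
  \<open>b2\<close> has the eigenvalues 1 and -1. In particular \<open>cvec 1 1\<close> is scaled by
  \<open>exp (- t)\<close>.\<close>

lemma mexp_b2:
  "mexp (t *\<^sub>R b2) = exp t *\<^sub>R cmat (1/2) (-1/2) (-1/2) (1/2) + exp (- t) *\<^sub>R cmat (1/2) (1/2) (1/2) (1/2)"
  by (rule mexp_eigenprojections)
    (simp_all add: matrix_mult_scaleR_left b_cmat cmat_scaleR cmat_1 cmat_add complex_eq_iff)

lemma BPS_iff: "cvec z w \<in> BPS \<longleftrightarrow> z \<noteq> 0 \<and> cmod z = cmod w"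
proof -
  have "(cmod z)\<^sup>2 = (cmod w)\<^sup>2 \<longleftrightarrow> cmod z = cmod w" by simp
  then show ?thesis unfolding BPS_def by auto
qed

section \<open>Null vectors: stabilizers and the section of the orbit map\<close>

definition stab_gen :: "complex \<Rightarrow> complex \<Rightarrow> real^4^4" where
  "stab_gen z w = cmat (\<i> * z * cnj z) (- \<i> * z * cnj w) (\<i> * w * cnj z) (- \<i> * w * cnj w)"

text \<open>With r = |z| = |w|, the entry z(1 + c)/2 is (z/r)(r + 1/r)/2, and similarly for the
  others. Only the square of r occurs, which keeps the formula rational in the real
  coordinates.\<close>

definition lift :: "complex \<Rightarrow> complex \<Rightarrow> real^4^4" where
  "lift z w = (let c = of_real (1 / (cmod z)\<^sup>2) in
     cmat (z * (1 + c) / 2) (z * (1 - c) / 2) (w * (1 - c) / 2) (w * (1 + c) / 2))"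

text \<open>For a null vector the diagonal entries are opposite, so the matrix is traceless and has
  no \<open>b4\<close> component.\<close>

lemma stab_gen_in_kstar_algebra:
  assumes "cmod z = cmod w" shows "stab_gen z w \<in> kstar_algebra"
proof -
  have "(cmod z)\<^sup>2 = (cmod w)\<^sup>2" using assms by simp
  then have "stab_gen z w = (cmod z)\<^sup>2 *\<^sub>R b1 + (- Im (z * cnj w)) *\<^sub>R b2 + Re (z * cnj w) *\<^sub>R b3 + 0 *\<^sub>R b4"
    unfolding cmod_power2
    by (simp add: stab_gen_def b_cmat cmat_scaleR cmat_add complex_eq_iff power2_eq_square algebra_simps)
  then show ?thesis unfolding kstar_algebra_iff by blast
qed

text \<open>Every entry of the square contains the factor \<open>z * cnj z - w * cnj w\<close>, the
  Hermitian norm of the null vector.\<close>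

lemma stab_gen_square:
  assumes "cmod z = cmod w" shows "stab_gen z w ** stab_gen z w = 0"
proof -
  have "z * cnj z = w * cnj w" using assms by (simp add: complex_norm_square[symmetric])
  then have "(\<i> * z * cnj z) * (\<i> * z * cnj z) + (- \<i> * z * cnj w) * (\<i> * w * cnj z) = 0"
    "(\<i> * z * cnj z) * (- \<i> * z * cnj w) + (- \<i> * z * cnj w) * (- \<i> * w * cnj w) = 0"
    "(\<i> * w * cnj z) * (\<i> * z * cnj z) + (- \<i> * w * cnj w) * (\<i> * w * cnj z) = 0"
    "(\<i> * w * cnj z) * (- \<i> * z * cnj w) + (- \<i> * w * cnj w) * (- \<i> * w * cnj w) = 0"
    by algebra+
  moreover have "cmat 0 0 0 0 = 0" by (simp add: cmat_simps)
  ultimately show ?thesis unfolding stab_gen_def cmat_mult by (simp only:)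
qed

lemma stab_gen_fixes:
  assumes "cmod z = cmod w" shows "(mat 1 + t *\<^sub>R stab_gen z w) *v cvec z w = cvec z w"
proof -
  have "z * cnj z = w * cnj w" using assms by (simp add: complex_norm_square[symmetric])
  then have "\<i> * z * cnj z * z + - \<i> * z * cnj w * w = 0" "\<i> * w * cnj z * z + - \<i> * w * cnj w * w = 0"
    by algebra+
  then have "stab_gen z w *v cvec z w = 0" unfolding stab_gen_def cmat_cvec by simp
  then show ?thesis
    by (simp add: matrix_vector_mult_add_rdistrib scaleR_matrix_vector_assoc[symmetric])
qed

lemma mexp_stab_gen:
  assumes "cmod z = cmod w" shows "mexp (t *\<^sub>R stab_gen z w) = mat 1 + t *\<^sub>R stab_gen z w"
  by (rule mexp_nilpotent) (simp add: matrix_mult_scaleR_left matrix_mult_scaleR_right stab_gen_square assms)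

lemma stabilizer_form:
  assumes "A \<in> U11" "A *v cvec z w = cvec z w" "z \<noteq> 0" "cmod z = cmod w"
  obtains t where "A = mat 1 + t *\<^sub>R stab_gen z w"
proof -
  obtain a b c d where A: "A = cmat a b c d"
    using assms(1) commute_b4_imp_cmat unfolding U11_def by blast
  have w: "w \<noteq> 0" using assms(3,4) by (metis norm_eq_zero)
  define R where "R = (cmod z)\<^sup>2"
  have R: "z * cnj z = of_real R" "w * cnj w = of_real R" "cnj z * z = of_real R" "cnj w * w = of_real R" "R > 0"
    using assms w by (simp_all add: R_def complex_norm_square[symmetric] mult.commute[of "cnj _"])
  \<comment> \<open>Fixing the vector determines \<open>a\<close> from \<open>b\<close> and
    \<open>d\<close> from \<open>c\<close>; \<open>K\<close> and \<open>L\<close> are the resulting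
    deviations \<open>a - 1\<close> and \<open>1 - d\<close>.\<close>
  define K L where KL: "K = - b * w / z" "L = c * z / w"
  have f: "a * z + b * w = z" "c * z + d * w = w" using assms(2) by (simp_all add: A)
  have abcd: "a = 1 + K" "b * w = - K * z" "c * z = L * w" "d = 1 - L"
    using f \<open>z \<noteq> 0\<close> w by (auto simp: KL field_simps)
  have n: "cmod b = cmod K" "cmod c = cmod L"
    using assms(3,4) w by (auto simp: KL norm_mult norm_divide)
  have U: "(cmod (1 + K))\<^sup>2 - (cmod L)\<^sup>2 = 1" "(cmod (1 - L))\<^sup>2 - (cmod K)\<^sup>2 = 1" "cnj a * b = cnj c * d"
    using assms(1) unfolding A cmat_in_U11_iff n abcd(1,4) by auto
  \<comment> \<open>The orthogonality relation is multiplied by \<open>w * cnj z\<close>, so that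
    \<open>b\<close> and \<open>c\<close> occur only in \<open>b * w\<close> and
    \<open>c * z\<close>; the common factor \<open>R\<close> is cancelled afterwards.\<close>
  have "cnj (1 + K) * (- K) * (z * cnj z) = cnj a * (b * w) * cnj z"
    unfolding abcd(2) by (simp add: abcd(1) mult_ac)
  also have "\<dots> = cnj (c * z) * d * w" using U(3) by (simp add: mult_ac)
  also have "\<dots> = cnj L * (1 - L) * (w * cnj w)" unfolding abcd(3) by (simp add: abcd(4) mult_ac)
  finally have "cnj (1 + K) * (- K) * of_real R = cnj L * (1 - L) * of_real R"
    unfolding R .
  moreover have "complex_of_real R \<noteq> 0" using R(5) by simp
  ultimately have U3: "cnj (1 + K) * (- K) = cnj L * (1 - L)"
    using mult_right_cancel by blast
  \<comment> \<open>Adding the two norm relations cancels the squared moduli. The imaginary part of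
    \<open>U3\<close> then gives \<open>K = L\<close>, and a norm relation makes this number purely
    imaginary.\<close>
  have rl: "Re K = Re L" using U(1,2) unfolding cmod_power2 by (simp add: power2_eq_square algebra_simps)
  have il: "Im K = Im L" using U3 by (simp add: complex_eq_iff algebra_simps)
  have r0: "Re K = 0" using U(1) rl il unfolding cmod_power2 by (simp add: power2_eq_square algebra_simps)
  obtain k :: real where K: "K = k * \<i>" "L = k * \<i>"
    using rl il r0 by (auto intro!: that[of "Im K"] simp: complex_eq_iff)
  \<comment> \<open>The upper left entry of \<open>stab_gen z w\<close> is \<open>\<i> * R\<close>,
    and it must be scaled to \<open>K = k * \<i>\<close>.\<close>
  have "A = mat 1 + (k / R) *\<^sub>R stab_gen z w"
  proof -
    have "b * R = b * w * cnj w" "c * R = c * z * cnj z" by (simp_all add: mult.assoc R)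
    then have "b * R = - K * z * cnj w" "c * R = L * w * cnj z" by (simp_all only: abcd)
    then have "b = - K * z * cnj w / R" "c = L * w * cnj z / R" using R(5) by (simp_all add: field_simps)
    then show ?thesis
      using R(5) unfolding K R(1-4) A stab_gen_def cmat_1 cmat_scaleR cmat_add cmat_inject
      by (simp add: abcd K R(1-4) scaleR_conv_of_real mult.assoc)
  qed
  then show thesis using that by blast
qed

text \<open>In each row sum the terms with \<open>c\<close> cancel.\<close>

lemma lift_apply: "lift z w *v cvec 1 1 = cvec z w"
  by (simp add: lift_def Let_def algebra_simps flip: add_divide_distrib)

lemma lift_eq_mexp:
  assumes "z \<noteq> 0" "cmod z = cmod w"
  obtains s t u where "lift z w = mexp (s *\<^sub>R b4) ** mexp (t *\<^sub>R b1) ** mexp (u *\<^sub>R b2)"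
proof
  define r where "r = cmod z"
  have r: "r > 0" "z = r * cis (Arg z)" "w = r * cis (Arg w)"
    using assms cis_Arg[of z] cis_Arg[of w] by (auto simp: r_def rcis_cmod_Arg[unfolded rcis_def] sgn_eq)
  \<comment> \<open>\<open>b1\<close> turns the two coordinates in opposite directions and
    \<open>b4\<close> turns both alike, clockwise. Hence the half difference and minus the half sum
    of the arguments.\<close>
  let ?s = "- (Arg z + Arg w) / 2" and ?t = "(Arg z - Arg w) / 2"
  have c: "cis (- ?s) * cis ?t = cis (Arg z)" "cis (- ?s) * cis (- ?t) = cis (Arg w)"
    by (simp_all add: cis_mult field_simps)
  have e: "exp (- ln r) = 1 / r" "exp (- (- ln r)) = r" using r(1) by (simp_all add: exp_minus field_simps)
  have "mexp (?s *\<^sub>R b4) ** mexp (?t *\<^sub>R b1) = cmat (cis (Arg z)) 0 0 (cis (Arg w))"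
    unfolding mexp_b4 mexp_b1 cmat_mult c by (simp add: c)
  \<comment> \<open>The parameter is negative because \<open>mexp (u *\<^sub>R b2)\<close> scales
    \<open>cvec 1 1\<close> by \<open>exp (- u)\<close>, and the factor \<open>r\<close> is
    wanted.\<close>
  moreover have "mexp (- ln r *\<^sub>R b2) = cmat (of_real (r + 1/r) / 2) (of_real (r - 1/r) / 2) (of_real (r - 1/r) / 2) (of_real (r + 1/r) / 2)"
    unfolding mexp_b2 e cmat_scaleR cmat_add by (simp add: scaleR_conv_of_real field_simps)
  moreover have "lift z w = cmat (cis (Arg z) * (of_real (r + 1/r) / 2)) (cis (Arg z) * (of_real (r - 1/r) / 2))
     (cis (Arg w) * (of_real (r - 1/r) / 2)) (cis (Arg w) * (of_real (r + 1/r) / 2))"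
    unfolding lift_def Let_def r_def[symmetric]
    by (subst (1 2) r(2), subst (1 2) r(3)) (use r(1) in \<open>simp add: field_simps power2_eq_square\<close>)
  ultimately show "lift z w = mexp (?s *\<^sub>R b4) ** mexp (?t *\<^sub>R b1) ** mexp (- ln r *\<^sub>R b2)"
    by simp
qed

text \<open>One inclusion holds for the generators. Conversely, \<open>A\<close> and the lift of the
  image of \<open>cvec 1 1\<close> under \<open>A\<close> agree on that vector, so they differ by an
  element of its stabilizer. The lift is a product of exponentials and the stabilizer element is a
  single exponential.\<close>

lemma carrier_Kstar: "carrier Kstar = U11"
proof -
  interpret group SO22 by (rule group_SO22)
  let ?G = "generate SO22 (mexp ` kstar_algebra)"
  have sub: "?G \<subseteq> U11"
    by (rule generate_subgroup_incl[OF _ U11_subgroup]) (use mexp_in_U11 in blast)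
  have mult: "A ** B \<in> ?G" if "A \<in> ?G" "B \<in> ?G" for A B
    using generate.eng[OF that] by (simp add: SO22_def)
  have expG: "mexp X \<in> ?G" if "X \<in> kstar_algebra" for X
    using that by (auto intro: generate.incl)
  have "A \<in> ?G" if A: "A \<in> U11" for A
  proof -
    obtain z w where zw: "A *v cvec 1 1 = cvec z w" by (rule cvec_cases)
    have "Delta2 (A *v cvec 1 1) = Delta2 (cvec 1 1)" using A unfolding U11_def by blast
    then have "(cmod z)\<^sup>2 = (cmod w)\<^sup>2" by (simp add: zw)
    then have n: "cmod z = cmod w" by simp
    have Ac: "A \<in> carrier SO22" using A U11_subgroup subgroup.subset by blast
    have "z \<noteq> 0"
    proof
      assume "z = 0"
      then have "A *v cvec 1 1 = 0" using n by (simp add: zw)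
      then have "inv\<^bsub>SO22\<^esub> A ** A *v cvec 1 1 = 0" by (simp flip: matrix_vector_mul_assoc)
      then show False using inv_SO22[OF Ac] by simp
    qed
    then obtain s t u where "lift z w = mexp (s *\<^sub>R b4) ** mexp (t *\<^sub>R b1) ** mexp (u *\<^sub>R b2)"
      using lift_eq_mexp n by metis
    then have S: "lift z w \<in> ?G"
      by (simp add: mult expG scaleR_b_in_kstar_algebra)
    then have Sc: "lift z w \<in> U11" "lift z w \<in> carrier SO22"
      using sub U11_subgroup subgroup.subset by blast+
    let ?B = "inv\<^bsub>SO22\<^esub> (lift z w) ** A"
    have "?B \<in> U11"
      using subgroup.m_closed[OF U11_subgroup subgroup.m_inv_closed[OF U11_subgroup Sc(1)] A]
      by (simp add: SO22_def)
    moreover have "?B *v cvec 1 1 = cvec 1 1"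
    proof -
      have "?B *v cvec 1 1 = inv\<^bsub>SO22\<^esub> (lift z w) *v (lift z w *v cvec 1 1)"
        by (simp add: lift_apply zw flip: matrix_vector_mul_assoc)
      then show ?thesis using inv_SO22[OF Sc(2)] by (simp add: matrix_vector_mul_assoc)
    qed
    ultimately obtain t where "?B = mat 1 + t *\<^sub>R stab_gen 1 1"
      by (rule stabilizer_form) auto
    then have "?B \<in> ?G"
      using expG[of "t *\<^sub>R stab_gen 1 1"] stab_gen_in_kstar_algebra[of 1 1] mexp_stab_gen[of 1 1 t]
      by (simp add: kstar_algebra_def span_scale)
    moreover have "A = lift z w ** ?B"
      using inv_SO22[OF Sc(2)] by (simp add: matrix_mul_assoc)
    ultimately show ?thesis using mult S by metis
  qed
  then show ?thesis using sub by (auto simp: Kstar_def)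
qed

lemma Kstar_simps [simp]: "mult Kstar = (**)" "one Kstar = mat 1" "carrier Kstar = U11"
  by (simp_all add: carrier_Kstar) (simp_all add: Kstar_def SO22_def)

section \<open>The action on nonzero null vectors\<close>

lemma group_Kstar: "group Kstar"
proof -
  have "Kstar = SO22\<lparr>carrier := U11\<rparr>" using carrier_Kstar unfolding Kstar_def by simp
  then show ?thesis using group.subgroup_imp_group[OF group_SO22 U11_subgroup] by simp
qed

lemma U11_inverse:
  assumes "A \<in> U11" obtains B where "B \<in> U11" "A ** B = mat 1" "B ** A = mat 1"
  using group.inv_closed[OF group_Kstar, of A] group.l_inv[OF group_Kstar, of A]
    group.r_inv[OF group_Kstar, of A] assms by simp

lemma U11_mult: "A \<in> U11 \<Longrightarrow> B \<in> U11 \<Longrightarrow> A ** B \<in> U11"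
  using monoid.m_closed[OF group.is_monoid[OF group_Kstar], of A B] by simp

lemma U11_BPS:
  assumes "A \<in> U11" "v \<in> BPS" shows "A *v v \<in> BPS"
proof -
  obtain B where B: "B ** A = mat 1" using U11_inverse[OF assms(1)] by blast
  have "A *v v \<noteq> 0"
  proof
    assume "A *v v = 0"
    then have "B ** A *v v = 0" by (simp flip: matrix_vector_mul_assoc)
    then show False using assms(2) B by (simp add: BPS_def)
  qed
  then show ?thesis using assms by (simp add: BPS_def U11_def)
qed

lemma lift_in_U11:
  assumes "cvec z w \<in> BPS" shows "lift z w \<in> U11"
proof -
  obtain s t u where "lift z w = mexp (s *\<^sub>R b4) ** mexp (t *\<^sub>R b1) ** mexp (u *\<^sub>R b2)"
    using assms lift_eq_mexp unfolding BPS_iff by metis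
  then show ?thesis
    by (simp add: U11_mult mexp_in_U11 scaleR_b_in_kstar_algebra)
qed

text \<open>\<open>charge_action\<close> is restricted to \<open>BPS\<close>, which makes each map
  extensional as \<open>Bij\<close> and \<open>compose\<close> require.\<close>

lemma group_action_Kstar: "group_action Kstar BPS charge_action"
proof -
  have Bij: "charge_action A \<in> Bij BPS" if A: "A \<in> U11" for A
  proof -
    obtain B where B: "B \<in> U11" "A ** B = mat 1" "B ** A = mat 1" using U11_inverse[OF A] .
    have "bij_betw (charge_action A) BPS BPS"
      by (rule bij_betw_byWitness[of _ "charge_action B"])
        (use A B U11_BPS in \<open>auto simp: charge_action_def matrix_vector_mul_assoc\<close>)
    then show ?thesis by (simp add: Bij_def charge_action_def)
  qed
  have "charge_action (A ** B) = compose BPS (charge_action A) (charge_action B)" if "B \<in> U11" for A B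
    using U11_BPS[OF that] by (auto simp: charge_action_def compose_def matrix_vector_mul_assoc)
  then have "charge_action \<in> hom Kstar (BijGroup BPS)"
    using Bij by (auto simp: hom_def BijGroup_def)
  then show ?thesis
    by (intro group_action.intro group_hom.intro group_hom_axioms.intro group_Kstar group_BijGroup)
qed

section \<open>The smooth section and the stabilizers on \<open>BPS\<close>\<close>

definition BPS_lift :: "real^4 \<Rightarrow> real^4^4" where
  "BPS_lift x = lift (Complex (x$1) (x$2)) (Complex (x$3) (x$4))"

lemma BPS_lift_cvec [simp]: "BPS_lift (cvec z w) = lift z w"
  by (simp add: BPS_lift_def)

lemma BPS_lift:
  assumes "x \<in> BPS" shows "BPS_lift x \<in> U11" "BPS_lift x *v cvec 1 1 = x"
  using assms lift_in_U11 lift_apply by (cases x rule: cvec_cases; simp)+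

text \<open>The section is a linear map plus another linear map divided by the quadratic form
  \<open>R\<close>, which is |z|^2. It is therefore smooth on the open set where \<open>R\<close> is
  nonzero, and this set contains \<open>BPS\<close>.\<close>

lemma smooth_on_BPS_lift: "smooth_on BPS BPS_lift"
proof -
  define L1 where "L1 x = (let z = Complex (x$1) (x$2) / 2; w = Complex (x$3) (x$4) / 2 in cmat z z w w)" for x :: "real^4"
  define L2 where "L2 x = (let z = Complex (x$1) (x$2) / 2; w = Complex (x$3) (x$4) / 2 in cmat z (- z) (- w) w)" for x :: "real^4"
  define R :: "real^4 \<Rightarrow> real" where "R x = x$1 * x$1 + x$2 * x$2" for x
  have eq: "BPS_lift x = L1 x + inverse (R x) *\<^sub>R L2 x" for x
  proof -
    have "(cmod (Complex (x$1) (x$2)))\<^sup>2 = R x"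
      by (simp add: cmod_power2 R_def power2_eq_square[of "_ $ _"])
    then show ?thesis
      unfolding BPS_lift_def lift_def L1_def L2_def Let_def cmat_scaleR cmat_add cmat_inject
      by (simp add: scaleR_conv_of_real inverse_eq_divide algebra_simps add_divide_distrib diff_divide_distrib)
  qed
  have L: "bounded_linear L1" "bounded_linear L2"
    unfolding linear_conv_bounded_linear[symmetric]
    by (auto intro!: linearI simp: L1_def L2_def Let_def cmat_add cmat_scaleR complex_eq_iff field_simps)
  have R: "C_k k UNIV R" for k
    unfolding R_def
    by (intro C_k_add C_k_bilinear[OF bounded_bilinear_mult] C_k_bounded_linear bounded_linear_vec_nth open_UNIV)
  let ?U = "R -` (- {0})"
  have "continuous_on UNIV R" using C_k_imp_continuous_on[OF R] .
  then have U: "open ?U" by (intro open_vimage) auto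
  have "C_k k ?U BPS_lift" for k
    unfolding eq
    by (intro C_k_add C_k_bilinear[OF bounded_bilinear_scaleR] C_k_compose[OF _ C_k_subset[OF R] C_k_inverse]
        C_k_bounded_linear L U) auto
  moreover have "BPS \<subseteq> ?U"
  proof
    fix x assume "x \<in> BPS"
    then show "x \<in> ?U"
      by (cases x rule: cvec_cases) (auto simp: BPS_iff R_def complex_eq_iff)
  qed
  ultimately show ?thesis by (intro smooth_onI[OF U])
qed

lemma stab_gen_nonzero:
  assumes "z \<noteq> 0" shows "stab_gen z w \<noteq> 0"
proof
  assume "stab_gen z w = 0"
  also have "0 = cmat 0 0 0 0" by (simp add: cmat_simps)
  finally show False using assms by (simp add: stab_gen_def)
qed

lemma stabilizer_BPS:
  assumes "cvec z w \<in> BPS"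
  shows "stabilizer Kstar charge_action (cvec z w) = range (\<lambda>t. mat 1 + t *\<^sub>R stab_gen z w)"
proof -
  have zw: "z \<noteq> 0" "cmod z = cmod w" using assms by (simp_all add: BPS_iff)
  have "mat 1 + t *\<^sub>R stab_gen z w \<in> U11" for t
    using mexp_in_U11[of "t *\<^sub>R stab_gen z w"] stab_gen_in_kstar_algebra[OF zw(2)] mexp_stab_gen[OF zw(2), of t]
    by (simp add: kstar_algebra_def span_scale)
  moreover have "A \<in> range (\<lambda>t. mat 1 + t *\<^sub>R stab_gen z w)"
    if "A \<in> U11" "A *v cvec z w = cvec z w" for A
    using stabilizer_form[OF that zw] by blast
  ultimately show ?thesis
    using assms stab_gen_fixes[OF zw(2)]
    by (auto simp: stabilizer_def charge_action_def)
qed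

theorem theorem6p2p1:
  shows "transitive_action Kstar BPS charge_action \<and>
    (\<forall>v\<in>BPS.
      (\<exists>X\<in>kstar_algebra.
         (\<lambda>t. mexp (t *\<^sub>R X)) \<in>
           iso real_add_group (Kstar\<lparr>carrier := stabilizer Kstar charge_action v\<rparr>) \<and>
         diffeomorphism UNIV (stabilizer Kstar charge_action v) (\<lambda>t. mexp (t *\<^sub>R X))) \<and>
      (\<exists>\<Phi>. \<Phi> (stabilizer Kstar charge_action v) = v \<and>
         homogeneous_space_iso Kstar (stabilizer Kstar charge_action v) BPS charge_action \<Phi>))"
proof (intro conjI ballI)
  \<comment> \<open>Right multiplication by the inverse of \<open>BPS_lift v\<close> moves the base
    point of the section from \<open>cvec 1 1\<close> to \<open>v\<close>. Transitivity and the
    section needed for the quotient both come from this.\<close>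
  have translate: "\<exists>B\<in>U11. \<forall>x\<in>BPS. BPS_lift x ** B \<in> U11 \<and> BPS_lift x ** B *v v = x" if v: "v \<in> BPS" for v
  proof -
    obtain B where B: "B \<in> U11" "B ** BPS_lift v = mat 1"
      using U11_inverse BPS_lift(1)[OF v] by metis
    have "B *v v = B *v (BPS_lift v *v cvec 1 1)" using BPS_lift(2)[OF v] by simp
    then have "B *v v = cvec 1 1" using B(2) by (simp add: matrix_vector_mul_assoc)
    then have "BPS_lift x ** B *v v = x" if "x \<in> BPS" for x
      using BPS_lift(2)[OF that] by (simp flip: matrix_vector_mul_assoc)
    then show ?thesis using B(1) BPS_lift(1) U11_mult by blast
  qed
  show "transitive_action Kstar BPS charge_action"
  proof (intro transitive_action.intro group_action_Kstar transitive_action_axioms.intro)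
    fix x y assume "x \<in> BPS" "y \<in> BPS"
    then show "\<exists>g\<in>carrier Kstar. charge_action g x = y"
      using translate[of x] by (auto simp: charge_action_def)
  qed
  fix v assume v: "v \<in> BPS"
  obtain z w where vzw: "v = cvec z w" by (rule cvec_cases)
  have zw: "z \<noteq> 0" "cmod z = cmod w" using v by (simp_all add: BPS_iff vzw)
  define X where "X = stab_gen z w"
  have X: "X \<in> kstar_algebra" "X \<noteq> 0" "X ** X = 0"
    using zw stab_gen_in_kstar_algebra stab_gen_nonzero stab_gen_square by (auto simp: X_def)
  have e: "mexp (t *\<^sub>R X) = mat 1 + t *\<^sub>R X" for t unfolding X_def by (rule mexp_stab_gen[OF zw(2)])
  have st: "stabilizer Kstar charge_action v = range (\<lambda>t. mat 1 + t *\<^sub>R X)"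
    using stabilizer_BPS v unfolding vzw X_def by blast
  have inj: "inj (\<lambda>t. mat 1 + t *\<^sub>R X)" using X(2) by (auto intro!: injI)
  then have bij: "bij_betw (\<lambda>t. mat 1 + t *\<^sub>R X) UNIV (stabilizer Kstar charge_action v)"
    unfolding st by (simp add: bij_betw_def)
  show "\<exists>X\<in>kstar_algebra.
         (\<lambda>t. mexp (t *\<^sub>R X)) \<in>
           iso real_add_group (Kstar\<lparr>carrier := stabilizer Kstar charge_action v\<rparr>) \<and>
         diffeomorphism UNIV (stabilizer Kstar charge_action v) (\<lambda>t. mexp (t *\<^sub>R X))"
  proof (intro bexI[OF _ X(1)] conjI)
    \<comment> \<open>The product term in \<open>s * t\<close> carries \<open>X ** X = 0\<close>, so
      multiplication in the stabilizer is addition of parameters.\<close>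
    have "mat 1 + (s + t) *\<^sub>R X = (mat 1 + s *\<^sub>R X) ** (mat 1 + t *\<^sub>R X)" for s t
      using X(3)
      by (simp add: bounded_bilinear.add_left[OF bounded_bilinear_matrix_mult] matrix_add_ldistrib
          matrix_mult_scaleR_left matrix_mult_scaleR_right scaleR_add_left)
    then show "(\<lambda>t. mexp (t *\<^sub>R X)) \<in> iso real_add_group (Kstar\<lparr>carrier := stabilizer Kstar charge_action v\<rparr>)"
      using bij unfolding e iso_def hom_def by (auto simp: real_add_group_def st)
    have "smooth_on UNIV (\<lambda>t. mat 1 + t *\<^sub>R X)"
      by (rule smooth_onI[OF open_UNIV subset_UNIV
            C_k_add[OF open_UNIV C_k_const C_k_bounded_linear[OF bounded_linear_scaleR_left]]])
    moreover have "smooth_on (stabilizer Kstar charge_action v)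
      (inv_into UNIV (\<lambda>t. mat 1 + t *\<^sub>R X))"
    proof (rule smooth_on_cong)
      \<comment> \<open>The parameter is recovered as the coefficient of \<open>A - mat 1\<close>
        along \<open>X\<close> under the inner product of matrices. This affine function is defined
        on all matrices, so it is a global smooth extension.\<close>
      show "smooth_on (stabilizer Kstar charge_action v) (\<lambda>A. (A \<bullet> X) / (X \<bullet> X) + - ((mat 1 \<bullet> X) / (X \<bullet> X)))"
        by (rule smooth_onI[OF open_UNIV subset_UNIV C_k_add[OF open_UNIV _ C_k_const]],
            rule C_k_bounded_linear, rule bounded_linear_compose[OF bounded_linear_divide bounded_linear_inner_left])
      fix A assume "A \<in> stabilizer Kstar charge_action v"
      then obtain t where t: "A = mat 1 + t *\<^sub>R X" unfolding st by blast
      then have "inv_into UNIV (\<lambda>t. mat 1 + t *\<^sub>R X) A = t" using inv_into_f_f[OF inj UNIV_I, of t] by simp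
      then show "(A \<bullet> X) / (X \<bullet> X) + - ((mat 1 \<bullet> X) / (X \<bullet> X)) = inv_into UNIV (\<lambda>t. mat 1 + t *\<^sub>R X) A"
        using X(2) by (simp add: t inner_add_left add_divide_distrib)
    qed
    ultimately show "diffeomorphism UNIV (stabilizer Kstar charge_action v) (\<lambda>t. mexp (t *\<^sub>R X))"
      unfolding diffeomorphism_def e using bij by blast
  qed
  obtain B where B: "\<And>x. x \<in> BPS \<Longrightarrow> BPS_lift x ** B \<in> U11 \<and> BPS_lift x ** B *v v = x"
    using translate[OF v] by blast
  show "\<exists>\<Phi>. \<Phi> (stabilizer Kstar charge_action v) = v \<and>
         homogeneous_space_iso Kstar (stabilizer Kstar charge_action v) BPS charge_action \<Phi>"
  proof (rule homogeneous_space_iso_if_section[OF group_action_Kstar v])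
    have "bounded_linear (\<lambda>A::real^4^4. A *v v)"
      unfolding linear_conv_bounded_linear[symmetric]
      by (auto intro!: linearI simp: matrix_vector_mult_add_rdistrib scaleR_matrix_vector_assoc)
    then have "smooth_on (carrier Kstar) (\<lambda>A. A *v v)" by (rule smooth_on_bounded_linear)
    then show "smooth_on (carrier Kstar) (\<lambda>A. charge_action A v)"
      by (rule smooth_on_cong) (simp add: charge_action_def v)
    show "smooth_on BPS (\<lambda>x. BPS_lift x ** B)"
      by (rule smooth_on_compose[OF smooth_on_BPS_lift
            smooth_on_bounded_linear[OF bounded_bilinear.bounded_linear_left[OF bounded_bilinear_matrix_mult], of UNIV]]) simp
  qed (use B v in \<open>auto simp: charge_action_def\<close>)
qed

end
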